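(* For a word $u$ of length $n$, its left-seed array $\mathsf{LSeed}[1..n]$, where $\mathsf{LSeed}[i]=\mathrm{lseed}(u[1..i])$, can be computed in $O(n)$ time.
   Context: Words are over a finite alphabet; $u[1..i]$ is the prefix of length $i$. A word $s$ covers $w$ if every position of $w$ lies in some occurrence of $s$ in $w$. A seed of a word $x$ is a factor $s$ of $x$ such that $x$ is a factor of some word covered by $s$; a left seed of $x$ is a seed of $x$ which is a prefix of $x$; $\mathrm{lseed}(x)$ is the length of the shortest left seed of $x$. *)

theory Defs
  imports Main "HOL-Library.Sublist"
begin

definition occurs_at :: "'a list \<Rightarrow> 'a list \<Rightarrow> nat \<Rightarrow> bool" where
  "occurs_at s w i \<longleftrightarrow> i + length s \<le> length w \<and> take (length s) (drop i w) = s"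

definition covers :: "'a list \<Rightarrow> 'a list \<Rightarrow> bool" where
  "covers s w \<longleftrightarrow> (\<forall>j < length w. \<exists>i. occurs_at s w i \<and> i \<le> j \<and> j < i + length s)"

definition is_seed :: "'a list \<Rightarrow> 'a list \<Rightarrow> bool" where
  "is_seed s x \<longleftrightarrow> sublist s x \<and> (\<exists>w. covers s w \<and> sublist x w)"

definition is_left_seed :: "'a list \<Rightarrow> 'a list \<Rightarrow> bool" where
  "is_left_seed s x \<longleftrightarrow> is_seed s x \<and> prefix s x"

definition lseed :: "'a list \<Rightarrow> nat" where
  "lseed x = (LEAST m. \<exists>s. is_left_seed s x \<and> length s = m)"

text \<open>Registers and arrays are named by natural numbers; all cells hold unbounded integers.
  Available operations: constants, addition, subtraction, comparisons, indirect array access.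
  (No multiplication, so this model is no stronger than the standard word RAM.)\<close>

datatype aexp = Const int | Var nat | Plus aexp aexp | Minus aexp aexp | Load nat aexp
datatype bexp = BLess aexp aexp | BEq aexp aexp | BNot bexp | BAnd bexp bexp

datatype com =
    SKIP
  | Assign nat aexp
  | Store nat aexp aexp
  | Seq com com
  | If bexp com com
  | While bexp com

record state =
  regs :: "nat \<Rightarrow> int"
  mem  :: "nat \<Rightarrow> int \<Rightarrow> int"

fun aval :: "aexp \<Rightarrow> state \<Rightarrow> int" where
  "aval (Const c) s = c"
| "aval (Var x) s = regs s x"
| "aval (Plus a b) s = aval a s + aval b s"
| "aval (Minus a b) s = aval a s - aval b s"
| "aval (Load A a) s = mem s A (aval a s)"

fun bval :: "bexp \<Rightarrow> state \<Rightarrow> bool" where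
  "bval (BLess a b) s = (aval a s < aval b s)"
| "bval (BEq a b) s = (aval a s = aval b s)"
| "bval (BNot b) s = (\<not> bval b s)"
| "bval (BAnd b c) s = (bval b s \<and> bval c s)"

inductive big_step :: "com \<Rightarrow> state \<Rightarrow> nat \<Rightarrow> state \<Rightarrow> bool" where
  Skip: "big_step SKIP s 1 s"
| Assign: "big_step (Assign x a) s 1 (s\<lparr>regs := (regs s)(x := aval a s)\<rparr>)"
| Store: "big_step (Store A i a) s 1
            (s\<lparr>mem := (mem s)(A := (mem s A)(aval i s := aval a s))\<rparr>)"
| Seq: "big_step c1 s1 t1 s2 \<Longrightarrow> big_step c2 s2 t2 s3 \<Longrightarrow> big_step (Seq c1 c2) s1 (t1 + t2) s3"
| IfTrue: "bval b s \<Longrightarrow> big_step c1 s t s' \<Longrightarrow> big_step (If b c1 c2) s (t + 1) s'"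
| IfFalse: "\<not> bval b s \<Longrightarrow> big_step c2 s t s' \<Longrightarrow> big_step (If b c1 c2) s (t + 1) s'"
| WhileFalse: "\<not> bval b s \<Longrightarrow> big_step (While b c) s 1 s"
| WhileTrue: "bval b s1 \<Longrightarrow> big_step c s1 t1 s2 \<Longrightarrow> big_step (While b c) s2 t2 s3 \<Longrightarrow>
               big_step (While b c) s1 (t1 + t2 + 1) s3"

text \<open>Input convention: register 0 holds n = |u|, array 0 holds u[1..n] at indices 1..n,
  everything else is 0. Output convention: array 1 holds LSeed[1..n] at indices 1..n.\<close>
definition input_state :: "int list \<Rightarrow> state" where
  "input_state u = \<lparr> regs = (\<lambda>x. if x = 0 then int (length u) else 0),
                     mem = (\<lambda>A i. if A = 0 \<and> 1 \<le> i \<and> i \<le> int (length u)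
                                    then u ! nat (i - 1) else 0) \<rparr>"

end

theory Submission
  imports Defs
begin

text \<open>A prefix of \<open>x\<close> is a left seed of \<open>x\<close> iff it covers some prefix of \<open>x\<close> whose length is at
  least the shortest period of \<open>x\<close>: the rightmost overhanging occurrence yields a period, and
  conversely shifting the covered prefix by multiples of the period covers an extension of \<open>x\<close>.
  Hence \<open>lseed\<close> of the prefix of length \<open>i\<close> is the minimum, over all \<open>q\<close> between its shortest
  period and \<open>i\<close>, of the shortest cover length of the prefix of length \<open>q\<close>.
  Shortest periods come from the Knuth-Morris-Pratt failure function and shortest covers from
  Breslauer's on-line algorithm, which maintains for each \<open>m\<close> the last prefix \<open>R[m]\<close> whose shortest
  cover has length \<open>m\<close>. So \<open>LSeed[i]\<close> is the least \<open>m\<close> for which \<open>R[m]\<close> reaches the shortest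
  period; as \<open>LSeed\<close> is monotone, a pointer that only moves forward finds it.\<close>

section \<open>Borders and covers of prefixes\<close>

text \<open>Read as: the prefix of length \<open>k\<close> has an occurrence ending at \<open>i\<close>. Occurrences are
  indexed by their end positions throughout.\<close>
definition border :: "'a list \<Rightarrow> nat \<Rightarrow> nat \<Rightarrow> bool" where
  "border u k i \<longleftrightarrow> k \<le> i \<and> (\<forall>t<k. u ! t = u ! (i - k + t))"

definition prefix_covers :: "'a list \<Rightarrow> nat \<Rightarrow> nat \<Rightarrow> bool" where
  "prefix_covers u m i \<longleftrightarrow> (\<forall>j<i. \<exists>e\<le>i. border u m e \<and> e \<le> j + m \<and> j < e)"

definition longest_border :: "'a list \<Rightarrow> nat \<Rightarrow> nat" where
  "longest_border u i = Max {k. k < i \<and> border u k i}"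

definition cover_length :: "'a list \<Rightarrow> nat \<Rightarrow> nat" where
  "cover_length u i = (LEAST m. prefix_covers u m i)"

text \<open>The table \<open>R\<close> after \<open>i\<close> rounds, given by the same one-cell
  update that the program performs. The default 0 means that no nonempty prefix so far has shortest
  cover length \<open>m\<close>.\<close>

fun last_covered :: "'a list \<Rightarrow> nat \<Rightarrow> nat \<Rightarrow> nat" where
  "last_covered u 0 m = 0"
| "last_covered u (Suc i) m = (if cover_length u (Suc i) = m then Suc i else last_covered u i m)"

lemma border_refl [simp]: "border u k k"
  by (simp add: border_def)

lemma border_0 [simp]: "border u 0 k"
  by (simp add: border_def)

lemma border_le: "border u k i \<Longrightarrow> k \<le> i"
  by (simp add: border_def)

text \<open>\<open>c - b\<close> is where the occurrence of the prefix of length \<open>b\<close>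
  starts; whatever occurs inside that prefix occurs again inside this copy.\<close>

lemma border_shift:
  assumes "border u a e" "border u b c" "e \<le> b"
  shows "border u a (c - b + e)"
  unfolding border_def
proof (intro conjI allI impI)
  show "a \<le> c - b + e" using assms by (auto simp: border_def)
next
  fix t assume t: "t < a"
  have "u ! t = u ! (e - a + t)" using assms t by (auto simp: border_def)
  also have "\<dots> = u ! (c - b + (e - a + t))"
  proof -
    have "e - a + t < b" using assms t by (auto simp: border_def)
    then show ?thesis using assms(2) by (auto simp: border_def)
  qed
  also have "c - b + (e - a + t) = c - b + e - a + t"
    using assms by (auto simp: border_def)
  finally show "u ! t = u ! (c - b + e - a + t)" .
qed

lemma border_unshift:
  assumes "border u a (c - b + e)" "border u b c" "a \<le> e" "e \<le> b"
  shows "border u a e"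
  unfolding border_def
proof (intro conjI allI impI)
  show "a \<le> e" by fact
next
  fix t assume t: "t < a"
  have "u ! t = u ! (c - b + e - a + t)" using assms t by (auto simp: border_def)
  also have "c - b + e - a + t = c - b + (e - a + t)"
    using assms by auto
  also have "u ! (c - b + (e - a + t)) = u ! (e - a + t)"
  proof -
    have "e - a + t < b" using assms t by auto
    then show ?thesis using assms(2) by (auto simp: border_def)
  qed
  finally show "u ! t = u ! (e - a + t)" .
qed

lemma border_trans: "border u a b \<Longrightarrow> border u b c \<Longrightarrow> border u a c"
  using border_shift[of u a b b c] by (simp add: border_le)

lemma border_of_borders: "border u a c \<Longrightarrow> border u b c \<Longrightarrow> a \<le> b \<Longrightarrow> border u a b"
  using border_unshift[of u a c b b] by (simp add: border_le)

lemma border_Suc: "border u (Suc k) (Suc i) \<longleftrightarrow> border u k i \<and> u ! k = u ! i"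
  by (auto simp: border_def less_Suc_eq)

lemma longest_border:
  assumes "i > 0"
  shows "longest_border u i < i" "border u (longest_border u i) i"
proof -
  have "finite {k. k < i \<and> border u k i}" by simp
  moreover have "0 \<in> {k. k < i \<and> border u k i}" using assms by simp
  ultimately have "longest_border u i \<in> {k. k < i \<and> border u k i}"
    unfolding longest_border_def using Max_in by blast
  then show "longest_border u i < i" "border u (longest_border u i) i" by auto
qed

lemma longest_border_greatest: "k < i \<Longrightarrow> border u k i \<Longrightarrow> k \<le> longest_border u i"
  unfolding longest_border_def by (rule Max_ge) auto

lemma longest_border_eqI:
  assumes "k < i" "border u k i" "\<And>l. l < i \<Longrightarrow> border u l i \<Longrightarrow> l \<le> k"
  shows "longest_border u i = k"
proof (rule le_antisym)
  have "0 < i" using assms(1) by simp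
  then show "longest_border u i \<le> k" using assms(3) longest_border by blast
  show "k \<le> longest_border u i" using assms(1,2) by (rule longest_border_greatest)
qed

section \<open>Composing, restricting and extending covers\<close>

lemma prefix_covers_refl [simp]: "prefix_covers u i i"
  by (auto simp: prefix_covers_def)

lemma prefix_covers_border:
  assumes "prefix_covers u m i" "i > 0"
  shows "border u m i" "m > 0" "m \<le> i"
proof -
  obtain e where e: "e \<le> i" "border u m e" "e \<le> i - 1 + m" "i - 1 < e"
    using assms unfolding prefix_covers_def by (meson diff_less zero_less_one)
  then have "e = i" by auto
  then show "border u m i" "m > 0" "m \<le> i" using e assms border_le by auto
qed

lemma prefix_covers_trans:
  assumes "prefix_covers u a b" "prefix_covers u b c"
  shows "prefix_covers u a c"
  unfolding prefix_covers_def
proof (intro allI impI)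
  fix j assume "j < c"
  then obtain e where e: "e \<le> c" "border u b e" "e \<le> j + b" "j < e"
    using assms(2) unfolding prefix_covers_def by blast
  have be: "b \<le> e" using e border_le by blast
  then have "j - (e - b) < b" using e by auto
  then obtain e' where e': "e' \<le> b" "border u a e'" "e' \<le> j - (e - b) + a" "j - (e - b) < e'"
    using assms(1) unfolding prefix_covers_def by blast
  have "e - b + e' \<le> c" "e - b + e' \<le> j + a" "j < e - b + e'"
    using e(1,3,4) e'(1,3,4) be by linarith+
  then show "\<exists>e\<le>c. border u a e \<and> e \<le> j + a \<and> j < e"
    using border_shift[OF e'(2) e(2) e'(1)] by blast
qed

text \<open>An occurrence covering a position of the final copy of the prefix of length
  \<open>b\<close> either lies inside this copy and can be translated back, or starts before it. In
  the second case the position is among the first \<open>a\<close> of the copy, which the prefix of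
  length \<open>a\<close> covers by itself.\<close>

lemma prefix_covers_of_border:
  assumes "prefix_covers u a c" "border u b c" "a \<le> b"
  shows "prefix_covers u a b"
  unfolding prefix_covers_def
proof (intro allI impI)
  fix j assume j: "j < b"
  have bc: "b \<le> c" using assms border_le by blast
  then have "c - b + j < c" using j by auto
  then obtain e where e: "e \<le> c" "border u a e" "e \<le> c - b + j + a" "c - b + j < e"
    using assms(1) unfolding prefix_covers_def by blast
  show "\<exists>e\<le>b. border u a e \<and> e \<le> j + a \<and> j < e"
  proof (cases "c - b + a \<le> e")
    case True
    define e' where "e' = e - (c - b)"
    have e': "e = c - b + e'" "a \<le> e'" using True unfolding e'_def by linarith+
    have le: "e' \<le> b" "e' \<le> j + a" "j < e'" using e(1,3,4) bc e'(1) by linarith+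
    have "border u a e'" using border_unshift[OF _ assms(2) e'(2) le(1)] e(2) e'(1) by simp
    then show ?thesis using le by blast
  next
    case False
    then have "j < a" using e(4) by linarith
    then show ?thesis using assms(3) border_refl le_add2 by blast
  qed
qed

lemma prefix_covers_extend:
  assumes "prefix_covers u a q" "border u a i" "q \<le> i" "i \<le> q + a"
  shows "prefix_covers u a i"
  unfolding prefix_covers_def
proof (intro allI impI)
  fix j assume j: "j < i"
  show "\<exists>e\<le>i. border u a e \<and> e \<le> j + a \<and> j < e"
  proof (cases "j < q")
    case True
    then show ?thesis using assms unfolding prefix_covers_def by (meson le_trans)
  next
    case False
    then have "i \<le> j + a" using assms(4) by linarith
    then show ?thesis using assms(2) j by blast
  qed
qed

lemma prefix_covers_restrict:
  assumes "prefix_covers u a i" "border u a e" "e \<le> i"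
  shows "prefix_covers u a e"
  unfolding prefix_covers_def
proof (intro allI impI)
  fix j assume j: "j < e"
  then obtain e1 where "e1 \<le> i" "border u a e1" "e1 \<le> j + a" "j < e1"
    using assms unfolding prefix_covers_def by (meson less_le_trans)
  then show "\<exists>e'\<le>e. border u a e' \<and> e' \<le> j + a \<and> j < e'"
    using assms(2) j by (meson le_cases le_trans)
qed

lemma prefix_covers_previous:
  assumes "prefix_covers u a i" "a < i"
  obtains q where "q < i" "i \<le> q + a" "prefix_covers u a q" "q > 0"
proof -
  \<comment> \<open>The position just before the final occurrence of the cover: an occurrence
    covering it ends before \<open>i\<close>, and its end is the required \<open>q\<close>.\<close>
  have "i - a - 1 < i" using assms by auto
  then obtain e where e: "e \<le> i" "border u a e" "e \<le> i - a - 1 + a" "i - a - 1 < e"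
    using assms unfolding prefix_covers_def by blast
  have "e < i" "i \<le> e + a" "e > 0" using e(3,4) assms(2) by linarith+
  then show thesis using that prefix_covers_restrict[OF assms(1) e(2,1)] by blast
qed

lemma cover_length_covers: "prefix_covers u (cover_length u i) i"
  unfolding cover_length_def by (rule LeastI[of _ i]) simp

lemma cover_length_le: "prefix_covers u m i \<Longrightarrow> cover_length u i \<le> m"
  unfolding cover_length_def by (rule Least_le)

lemma cover_length_0 [simp]: "cover_length u 0 = 0"
  using cover_length_le[of u 0 0] by simp

lemma cover_length_pos: "i > 0 \<Longrightarrow> cover_length u i > 0"
  using prefix_covers_border(2) cover_length_covers by blast

lemma cover_length_le_self: "cover_length u i \<le> i"
  by (simp add: cover_length_le)

section \<open>Breslauer's recurrence\<close>

lemma last_covered_cases: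
  "last_covered u i m = 0 \<or>
   0 < last_covered u i m \<and> last_covered u i m \<le> i \<and> cover_length u (last_covered u i m) = m"
  by (induction i) auto

lemma last_covered_upper: "0 < q \<Longrightarrow> q \<le> i \<Longrightarrow> q \<le> last_covered u i (cover_length u q)"
proof (induction i)
  case (Suc i)
  then show ?case by (cases "q = Suc i") (auto simp: le_Suc_eq)
qed simp

lemma last_covered_ge_iff:
  assumes "0 < p"
  shows "p \<le> last_covered u i m \<longleftrightarrow> (\<exists>q. p \<le> q \<and> q \<le> i \<and> cover_length u q = m)"
proof
  assume "p \<le> last_covered u i m"
  then show "\<exists>q. p \<le> q \<and> q \<le> i \<and> cover_length u q = m"
    using last_covered_cases[of u i m] assms by auto
next
  assume "\<exists>q. p \<le> q \<and> q \<le> i \<and> cover_length u q = m"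
  then obtain q where q: "p \<le> q" "q \<le> i" "cover_length u q = m" by blast
  have "q \<le> last_covered u i (cover_length u q)"
    using last_covered_upper[of q i u] q assms by simp
  then show "p \<le> last_covered u i m" using q by simp
qed

text \<open>Covers of one word are borders of it, so a shorter cover covers every longer one. Hence
  a cover that no shorter prefix covers is the shortest.\<close>

lemma cover_length_of_shorter_cover:
  assumes "prefix_covers u c q" "q > 0" "\<And>m. prefix_covers u m c \<Longrightarrow> c \<le> m"
  shows "cover_length u q = c"
proof -
  let ?m = "cover_length u q"
  have "?m \<le> c" using assms(1) by (rule cover_length_le)
  moreover have "prefix_covers u ?m c"
    using prefix_covers_of_border[OF cover_length_covers] prefix_covers_border(1)[OF assms(1,2)]
      calculation by blast
  ultimately show ?thesis using assms(3) by (simp add: le_antisym)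
qed

text \<open>A shortest cover that is proper is a border, hence covers the longest border, and is
  then also the shortest cover of that border. This candidate covers the new prefix iff it covers an
  earlier prefix that reaches the start of its final occurrence. If the longest border is empty,
  \<open>c i\<close> and the table entry are both 0, and the test yields
  \<open>Suc i\<close>.\<close>

lemma cover_length_Suc:
  fixes u :: "'a list"
  defines "c i \<equiv> cover_length u (longest_border u (Suc i))"
  shows "cover_length u (Suc i) =
    (if last_covered u i (c i) < Suc i - c i then Suc i else c i)"
proof -
  let ?n = "Suc i" and ?f = "longest_border u (Suc i)" and ?c = "c i"
  note f = longest_border[of ?n u, simplified]
  have c_le: "?c \<le> ?f" unfolding c_def by (rule cover_length_le_self)
  have c_cov: "prefix_covers u ?c ?f" unfolding c_def by (rule cover_length_covers)
  have c_min: "?c \<le> m" if "prefix_covers u m ?c" for m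
    using that c_cov prefix_covers_trans cover_length_le unfolding c_def by blast
  have proper: "cover_length u ?n = ?c \<and> 0 < ?f" if "cover_length u ?n < ?n"
  proof -
    let ?m = "cover_length u ?n"
    have m: "prefix_covers u ?m ?n" by (rule cover_length_covers)
    have mb: "border u ?m ?n" "0 < ?m" using prefix_covers_border[OF m] by auto
    have mf: "?m \<le> ?f" using longest_border_greatest[OF that] mb by auto
    then have fpos: "0 < ?f" using mb by auto
    have mcf: "prefix_covers u ?m ?f" using prefix_covers_of_border[OF m] f(2) mf by blast
    then have cm: "?c \<le> ?m" unfolding c_def by (rule cover_length_le)
    have "border u ?m ?f" using prefix_covers_border mcf fpos by blast
    then have "prefix_covers u ?c ?m" using prefix_covers_of_border[OF c_cov] cm by blast
    then have "prefix_covers u ?c ?n" using prefix_covers_trans m by blast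
    then have "?m \<le> ?c" by (rule cover_length_le)
    then show ?thesis using cm fpos by (simp add: le_antisym)
  qed
  show ?thesis
  proof (cases "last_covered u i ?c < ?n - ?c")
    case True
    have "\<not> cover_length u ?n < ?n"
    proof
      assume lt: "cover_length u ?n < ?n"
      from proper[OF lt] have eq: "cover_length u ?n = ?c" by simp
      have "prefix_covers u ?c ?n" using cover_length_covers[of u ?n] eq by simp
      then obtain q where q: "q < ?n" "?n \<le> q + ?c" "prefix_covers u ?c q" "q > 0"
        using prefix_covers_previous lt eq by metis
      then have "cover_length u q = ?c" using cover_length_of_shorter_cover c_min by blast
      then have "q \<le> last_covered u i ?c" using last_covered_upper[of q i u] q by auto
      then show False using True q by auto
    qed
    then show ?thesis using True cover_length_le_self[of u ?n] by auto
  next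
    case False
    let ?q = "last_covered u i ?c"
    have "?c < ?n" using c_le f(1) by auto
    \<comment> \<open>\<open>False\<close> bounds the entry below by the positive number
      \<open>?n - ?c\<close>, so it is not the default 0.\<close>
    then have "0 < ?q" using False by auto
    then have q: "?q \<le> i" "cover_length u ?q = ?c" using last_covered_cases[of u i ?c] by auto
    have cq: "prefix_covers u ?c ?q" using cover_length_covers[of u ?q] q by simp
    have "?c > 0" using cover_length_pos[OF \<open>0 < ?q\<close>, of u] q by simp
    then have "?f > 0" using c_le by auto
    then have "border u ?c ?f" using prefix_covers_border c_cov by blast
    then have "border u ?c ?n" using border_trans f(2) by blast
    then have "prefix_covers u ?c ?n"
      using prefix_covers_extend[OF cq] q False by auto
    then have "cover_length u ?n < ?n" using cover_length_le \<open>?c < ?n\<close> le_less_trans by blast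
    then show ?thesis using proper False by auto
  qed
qed

section \<open>Left seeds and periods\<close>

lemma occurs_at_iff: "occurs_at s w i \<longleftrightarrow> i + length s \<le> length w \<and> (\<forall>t<length s. w ! (i + t) = s ! t)"
  by (auto simp: occurs_at_def list_eq_iff_nth_eq)

text \<open>Take the longest prefix \<open>q\<close> covered by the seed. If it stops short of
  \<open>i\<close>, the occurrence in \<open>w\<close> covering the next letter must run past the
  end of \<open>take i u\<close>, as it would otherwise extend the covered prefix. The overhang
  gives a border of length \<open>i - st\<close> with \<open>st \<le> q\<close>, so the shortest
  period is at most \<open>q\<close>.\<close>

lemma left_seed_imp_covers_period:
  assumes i: "0 < i" "i \<le> length u" "a \<le> i" and seed: "is_left_seed (take a u) (take i u)"
  shows "\<exists>q\<le>i. prefix_covers u a q \<and> i - longest_border u i \<le> q"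
proof -
  from seed obtain w where w: "covers (take a u) w" "sublist (take i u) w"
    by (auto simp: is_left_seed_def is_seed_def)
  then obtain ps ss where weq: "w = ps @ take i u @ ss" by (auto simp: sublist_def)
  let ?p = "length ps"
  have wnth: "w ! (?p + t) = u ! t" if "t < i" for t
    using that i unfolding weq by (simp add: nth_append)
  have wlen: "?p + i \<le> length w" using i unfolding weq by auto
  define q where "q = Max {q. q \<le> i \<and> prefix_covers u a q}"
  have fin: "finite {q. q \<le> i \<and> prefix_covers u a q}" by simp
  have ne: "a \<in> {q. q \<le> i \<and> prefix_covers u a q}" using i by simp
  have q: "q \<le> i" "prefix_covers u a q"
    using Max_in[OF fin] ne unfolding q_def by blast+
  have qmax: "e \<le> q" if "e \<le> i" "prefix_covers u a e" for e
    unfolding q_def using Max_ge[OF fin] that by simp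
  have aq: "a \<le> q" using qmax i by simp
  have "i - longest_border u i \<le> q"
  proof (cases "q = i")
    case False
    then have "q < i" using q by simp
    then have "?p + q < length w" using wlen by simp
    then obtain h where h: "occurs_at (take a u) w h" "h \<le> ?p + q" "?p + q < h + a"
      using w(1) i unfolding covers_def by (auto simp: min_absorb2)
    \<comment> \<open>The start relative to \<open>take i u\<close>. The difference is exact and
      positive, since the occurrence reaches beyond \<open>?p + q\<close> and
      \<open>a \<le> q\<close>.\<close>
    define st where "st = h - ?p"
    have hst: "h = ?p + st" "0 < st" "st \<le> q" "q < st + a" using h aq unfolding st_def by auto
    have occ: "w ! (h + t) = u ! t" if "t < a" for t
      using h(1) that i by (simp add: occurs_at_iff)
    have shift: "u ! t = u ! (st + t)" if "t < a" "st + t < i" for t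
      using occ[OF that(1)] wnth[OF that(2)] hst by (simp add: add.assoc)
    have over: "i < st + a"
    proof (rule ccontr)
      assume "\<not> i < st + a"
      then have "border u a (st + a)" using shift by (auto simp: border_def)
      then have "prefix_covers u a (st + a)"
        using prefix_covers_extend[OF q(2)] hst by auto
      then show False using qmax[of "st + a"] \<open>\<not> i < st + a\<close> hst by auto
    qed
    have "border u (i - st) i" using shift over hst \<open>q < i\<close> by (auto simp: border_def)
    moreover have "i - st < i" using hst i by simp
    ultimately have "i - st \<le> longest_border u i" by (simp add: longest_border_greatest)
    then show ?thesis using hst by auto
  qed simp
  then show ?thesis using q by blast
qed

lemma nth_mod_period:
  assumes "border u (i - p) i" "0 < p" "p \<le> i" "t < i"
  shows "u ! t = u ! (t mod p)"
  using assms(4)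
proof (induction t rule: less_induct)
  case (less t)
  show ?case
  proof (cases "t < p")
    case False
    then have "u ! (t - p) = u ! (p + (t - p))"
      using assms less.prems by (auto simp: border_def)
    then have "u ! t = u ! (t - p)" using False by simp
    also have "\<dots> = u ! ((t - p) mod p)" using less False assms(2) by simp
    also have "(t - p) mod p = t mod p" using False by (simp add: le_mod_geq)
    finally show ?thesis .
  qed simp
qed

text \<open>Copies of the covered prefix of length \<open>q\<close>, started at multiples of the
  period \<open>p\<close>, leave no gap because \<open>p \<le> q\<close>. They cover a periodic
  continuation of \<open>take i u\<close>.\<close>

lemma covers_period_imp_left_seed:
  assumes i: "0 < i" "i \<le> length u" and q: "q \<le> i" "prefix_covers u a q"
    and per: "i - longest_border u i \<le> q"
  shows "a \<le> i" "is_left_seed (take a u) (take i u)"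
proof -
  define p where "p = i - longest_border u i"
  have p: "0 < p" "p \<le> i" "border u (i - p) i" "p \<le> q"
    using longest_border[OF i(1), of u] per unfolding p_def by auto
  have aq: "a \<le> q" "0 < a" using prefix_covers_border[OF q(2)] p by auto
  then show ai: "a \<le> i" using q by simp
  note period = nth_mod_period[OF p(3,1,2)]
  \<comment> \<open>The end of the copy started at \<open>p * i\<close>; it is at least
    \<open>i\<close> because \<open>p\<close> is positive.\<close>
  let ?K = "p * i + q"
  define w where "w = map (\<lambda>t. u ! (t mod p)) [0..<?K]"
  have wnth: "w ! t = u ! (t mod p)" if "t < ?K" for t using that by (simp add: w_def)
  have "i \<le> ?K" using p by (simp add: trans_le_add1)
  then have "take i u = take i w"
    using i period by (auto simp: list_eq_iff_nth_eq w_def)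
  then have sub: "sublist (take i u) w" by simp
  have "covers (take a u) w"
    unfolding covers_def
  proof (intro allI impI)
    fix j assume "j < length w"
    then have j: "j < ?K" by (simp add: w_def)
    \<comment> \<open>Below \<open>p * i\<close>, the last multiple of \<open>p\<close> up to
      \<open>j\<close> leaves a remainder below \<open>p \<le> q\<close>; all later positions lie in
      the copy with \<open>r = i\<close>.\<close>
    obtain r where r: "r \<le> i" "p * r \<le> j" "j < p * r + q"
    proof (cases "j < p * i")
      case True
      have "j div p \<le> i" using True p by (metis less_mult_imp_div_less less_imp_le mult.commute)
      moreover have "j < p * (j div p) + q"
        using p by (metis add_less_cancel_left less_le_trans mod_less_divisor mult_div_mod_eq)
      ultimately show thesis using that[of "j div p"] by simp
    next
      case False
      then show thesis using that[of i] j by auto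
    qed
    have "j - p * r < q" using r by auto
    then obtain e where e: "e \<le> q" "border u a e" "e \<le> j - p * r + a" "j - p * r < e"
      using q(2) unfolding prefix_covers_def by blast
    define d where "d = e - a"
    have d: "e = d + a" using border_le[OF e(2)] unfolding d_def by simp
    have fits: "p * r + d + a \<le> ?K"
      using e(1) d mult_le_mono2[OF r(1), of p] by linarith
    have "occurs_at (take a u) w (p * r + d)"
      unfolding occurs_at_iff
    proof (intro conjI allI impI)
      show "p * r + d + length (take a u) \<le> length w"
        using fits ai i by (simp add: w_def)
    next
      fix t assume "t < length (take a u)"
      then have t: "t < a" by simp
      have "p * r + d + t < ?K" using t fits by linarith
      then have "w ! (p * r + d + t) = u ! ((p * r + (d + t)) mod p)"
        using wnth by (simp add: add.assoc)
      also have "\<dots> = u ! ((d + t) mod p)" by simp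
      also have "\<dots> = u ! (d + t)"
      proof -
        have "d + t < i" using t d e(1) q(1) by linarith
        then show ?thesis using period by simp
      qed
      also have "\<dots> = u ! t" using e(2) d t by (auto simp: border_def)
      finally show "w ! (p * r + d + t) = take a u ! t" using t by simp
    qed
    moreover have "p * r + d \<le> j" "j < p * r + d + a" using e(3,4) d r by linarith+
    ultimately show "\<exists>i. occurs_at (take a u) w i \<and> i \<le> j \<and> j < i + length (take a u)"
      using ai i by auto
  qed
  moreover have "prefix (take a u) (take i u)" using ai by (metis min.absorb1 take_is_prefix take_take)
  ultimately show "is_left_seed (take a u) (take i u)"
    using sub by (auto simp: is_left_seed_def is_seed_def)
qed

section \<open>Shortest left seeds of prefixes\<close>

lemma left_seed_self: "is_left_seed x x"
proof -
  have "covers x x" by (auto simp: covers_def occurs_at_def intro!: exI[of _ 0])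
  then show ?thesis by (auto simp: is_left_seed_def is_seed_def)
qed

lemma lseed_witness: "\<exists>s. is_left_seed s x \<and> length s = lseed x"
  unfolding lseed_def using left_seed_self
  by (intro LeastI_ex[of "\<lambda>m. \<exists>s. is_left_seed s x \<and> length s = m"]) blast

lemma lseed_le: "is_left_seed s x \<Longrightarrow> lseed x \<le> length s"
  unfolding lseed_def by (intro Least_le) blast

lemma lseed_le_length: "lseed x \<le> length x"
  using lseed_le left_seed_self by blast

lemma lseed_le_cover_length:
  assumes "0 < i" "i \<le> length u" "i - longest_border u i \<le> q" "q \<le> i"
  shows "lseed (take i u) \<le> cover_length u q"
proof -
  note s = covers_period_imp_left_seed[OF assms(1,2,4) cover_length_covers assms(3)]
  show ?thesis using lseed_le[OF s(2)] s(1) assms(2) by simp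
qed

lemma lseed_eq_cover_length:
  assumes "0 < i" "i \<le> length u"
  shows "\<exists>q. i - longest_border u i \<le> q \<and> q \<le> i \<and> cover_length u q = lseed (take i u)"
proof -
  obtain s where s: "is_left_seed s (take i u)" "length s = lseed (take i u)"
    using lseed_witness by blast
  let ?a = "lseed (take i u)"
  have a: "?a \<le> i" using lseed_le_length[of "take i u"] by simp
  have "prefix s (take i u)" using s by (simp add: is_left_seed_def)
  then have "s = take ?a u" using s a by (metis append_eq_conv_conj min.absorb1 prefix_def take_take)
  then obtain q where "q \<le> i" "prefix_covers u ?a q" "i - longest_border u i \<le> q"
    using left_seed_imp_covers_period[OF assms a] s by auto
  then show ?thesis
    using lseed_le_cover_length[OF assms] cover_length_le by (metis le_antisym)
qed

text \<open>A left seed of the longer prefix that fits into the shorter one is a left seed there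
  too; one that does not fit is longer than \<open>i\<close>, which bounds
  \<open>lseed (take i u)\<close>.\<close>

lemma lseed_take_Suc:
  assumes "Suc i \<le> length u"
  shows "lseed (take i u) \<le> lseed (take (Suc i) u)"
proof -
  let ?y = "take (Suc i) u"
  obtain s where s: "is_left_seed s ?y" "length s = lseed ?y" using lseed_witness by blast
  have pre: "prefix (take i u) ?y" by (metis lessI less_imp_le min.absorb1 take_is_prefix take_take)
  show ?thesis
  proof (cases "length s \<le> i")
    case True
    then have "prefix s (take i u)"
      using s pre assms by (auto simp: is_left_seed_def intro: prefix_length_prefix)
    then have "is_left_seed s (take i u)"
      using s pre unfolding is_left_seed_def is_seed_def
      by (meson prefix_imp_sublist sublist_order.order.trans)
    then show ?thesis using lseed_le s by metis
  next
    case False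
    then show ?thesis using lseed_le_length[of "take i u"] s by auto
  qed
qed

text \<open>The two parts identify \<open>lseed (take i u)\<close> as the least index whose table
  entry reaches the shortest period, that is, the first index at which the test of
  \<open>seed_loop\<close> fails.\<close>

lemma lseed_le_iff_last_covered:
  assumes "0 < i" "i \<le> length u"
  shows "i - longest_border u i \<le> last_covered u i m \<Longrightarrow> lseed (take i u) \<le> m"
    and "i - longest_border u i \<le> last_covered u i (lseed (take i u))"
proof -
  have "0 < i - longest_border u i" using longest_border(1)[OF assms(1), of u] by simp
  note ge = last_covered_ge_iff[OF this, of u i]
  show "i - longest_border u i \<le> last_covered u i m \<Longrightarrow> lseed (take i u) \<le> m"
    using lseed_le_cover_length[OF assms] unfolding ge by blast
  show "i - longest_border u i \<le> last_covered u i (lseed (take i u))"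
    using lseed_eq_cover_length[OF assms] unfolding ge by blast
qed

section \<open>Execution with time credits\<close>

text \<open>\<open>n\<close> is the time still available, and \<open>Q\<close> receives what remains
  of it. The existence of an execution includes termination.\<close>

definition wp :: "com \<Rightarrow> (nat \<Rightarrow> state \<Rightarrow> bool) \<Rightarrow> nat \<Rightarrow> state \<Rightarrow> bool" where
  "wp c Q n s \<longleftrightarrow> (\<exists>t s'. big_step c s t s' \<and> t \<le> n \<and> Q (n - t) s')"

lemma wp_SKIP: "1 \<le> n \<Longrightarrow> Q (n - 1) s \<Longrightarrow> wp SKIP Q n s"
  unfolding wp_def using big_step.Skip by blast

lemma wp_Assign:
  "1 \<le> n \<Longrightarrow> Q (n - 1) (s\<lparr>regs := (regs s)(x := aval a s)\<rparr>) \<Longrightarrow> wp (Assign x a) Q n s"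
  unfolding wp_def using big_step.Assign by blast

lemma wp_Store:
  "1 \<le> n \<Longrightarrow> Q (n - 1) (s\<lparr>mem := (mem s)(A := (mem s A)(aval i s := aval a s))\<rparr>)
    \<Longrightarrow> wp (Store A i a) Q n s"
  unfolding wp_def using big_step.Store by blast

lemma wp_Seq: "wp c1 (wp c2 Q) n s \<Longrightarrow> wp (Seq c1 c2) Q n s"
  unfolding wp_def using big_step.Seq by (fastforce simp: le_diff_conv2 add.commute)

lemma wp_If:
  assumes "1 \<le> n" "bval b s \<Longrightarrow> wp c1 Q (n - 1) s" "\<not> bval b s \<Longrightarrow> wp c2 Q (n - 1) s"
  shows "wp (If b c1 c2) Q n s"
proof -
  have "\<exists>t s'. big_step (If b c1 c2) s (t + 1) s' \<and> t \<le> n - 1 \<and> Q (n - 1 - t) s'"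
    using assms(2,3) big_step.IfTrue big_step.IfFalse unfolding wp_def by (cases "bval b s") blast+
  then show ?thesis
    using assms(1) unfolding wp_def by (metis add.commute diff_diff_left le_diff_conv2)
qed

lemma wp_While:
  assumes "1 \<le> n" "bval b s \<Longrightarrow> wp c (wp (While b c) Q) (n - 1) s" "\<not> bval b s \<Longrightarrow> Q (n - 1) s"
  shows "wp (While b c) Q n s"
proof (cases "bval b s")
  case True
  then obtain t1 s1 t2 s2 where
    "big_step c s t1 s1" "t1 \<le> n - 1" "big_step (While b c) s1 t2 s2" "t2 \<le> n - 1 - t1"
    "Q (n - 1 - t1 - t2) s2"
    using assms(2) unfolding wp_def by blast
  then show ?thesis
    using True assms(1) big_step.WhileTrue unfolding wp_def
    by (intro exI[of _ "t1 + t2 + 1"] exI[of _ s2]) auto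
next
  case False
  then show ?thesis using assms big_step.WhileFalse unfolding wp_def by blast
qed

section \<open>The program\<close>

text \<open>Register 1 is \<open>i\<close>, register 2 the border candidate \<open>j\<close>, register 3 the pointer \<open>m\<close>,
  register 4 a cover length. Array 2 is the failure function shifted by one in index and value,
  so that the zero-initialised cell 1 already stands for the missing proper border of the empty
  word; array 3 holds the shortest cover lengths and array 4 is \<open>R\<close>.\<close>

definition border_loop :: com where
  "border_loop = While
     (BAnd (BLess (Const 0) (Var 2)) (BNot (BEq (Load 0 (Var 2)) (Load 0 (Var 1)))))
     (Assign 2 (Load 2 (Var 2)))"

definition seed_loop :: com where
  "seed_loop = While (BLess (Load 4 (Var 3)) (Minus (Var 1) (Var 2)))
     (Assign 3 (Plus (Var 3) (Const 1)))"

definition body :: com where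
  "body =
     Seq (Assign 1 (Plus (Var 1) (Const 1)))
    (Seq border_loop
    (Seq (Assign 4 (Load 3 (Var 2)))
    (Seq (If (BLess (Load 4 (Var 4)) (Minus (Var 1) (Var 4))) (Assign 4 (Var 1)) SKIP)
    (Seq (Store 3 (Var 1) (Var 4))
    (Seq (Store 4 (Var 4) (Var 1))
    (Seq seed_loop
    (Seq (Store 1 (Var 1) (Var 3))
    (Seq (Assign 2 (Plus (Var 2) (Const 1)))
         (Store 2 (Plus (Var 1) (Const 1)) (Var 2))))))))))"

definition main_loop :: com where
  "main_loop = While (BLess (Var 1) (Var 0)) body"

text \<open>Also the first candidate of the next round: dropping the last letter of a nonempty
  proper border of the prefix of length \<open>Suc i\<close> leaves a proper border of the prefix of
  length \<open>i\<close>.\<close>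

definition failure :: "'a list \<Rightarrow> nat \<Rightarrow> nat" where
  "failure u i = (if i = 0 then 0 else Suc (longest_border u i))"

lemma failure_le: "failure u i \<le> i"
  using longest_border(1)[of i u] by (auto simp: failure_def)

text \<open>No proper border of the prefix of length \<open>Suc i\<close> exceeds \<open>j\<close>,
  and for positive \<open>j\<close> the length \<open>j - 1\<close> is a border of the prefix of
  length \<open>i\<close>. An iteration costs 2 and lowers \<open>j\<close>, so the credit
  \<open>2 * j\<close> pays for it; twice the final value is handed back on top of the reserve
  \<open>r\<close>.\<close>

lemma border_loop_wp:
  fixes u :: "int list"
  assumes "regs s 1 = int (Suc i)" "Suc i \<le> length u"
    and "\<And>x. 1 \<le> x \<Longrightarrow> x \<le> length u \<Longrightarrow> mem s 0 (int x) = u ! (x - 1)"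
    and "\<And>x. x \<le> i \<Longrightarrow> mem s 2 (int x + 1) = int (failure u x)"
    and "regs s 2 = int j" "j \<le> i" "j > 0 \<Longrightarrow> border u (j - 1) i"
    and "\<And>l. l \<le> i \<Longrightarrow> border u l (Suc i) \<Longrightarrow> l \<le> j"
    and "2 * j + r + 1 \<le> n"
    and "\<And>n'. 2 * longest_border u (Suc i) + r \<le> n' \<Longrightarrow>
           Q n' (s\<lparr>regs := (regs s)(2 := int (longest_border u (Suc i)))\<rparr>)"
  shows "wp border_loop Q n s"
  using assms
proof (induction j arbitrary: s n rule: less_induct)
  case (less j)
  note prems = less.prems
  let ?b = "BAnd (BLess (Const 0) (Var 2)) (BNot (BEq (Load 0 (Var 2)) (Load 0 (Var 1))))"
  have test: "bval ?b s \<longleftrightarrow> 0 < j \<and> u ! (j - 1) \<noteq> u ! i"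
    using prems(1,2,5,6) prems(3)[of j] prems(3)[of "Suc i"] by (cases "j = 0") auto
  show ?case
    unfolding border_loop_def
  proof (rule wp_While)
    show "1 \<le> n" using prems(9) by simp
  next
    assume "bval ?b s"
    then have j: "0 < j" "u ! (j - 1) \<noteq> u ! i" using test by auto
    let ?j = "failure u (j - 1)"
    have lt: "?j < j" using failure_le[of u "j - 1"] j by simp
    have load: "mem s 2 (int j) = int ?j" using prems(4)[of "j - 1"] prems(6) j
      by (simp add: of_nat_diff)
    \<comment> \<open>For \<open>l = Suc k\<close>, the mismatch excludes \<open>k = j - 1\<close>,
      so \<open>k\<close> is a proper border of the prefix of length \<open>j - 1\<close>.\<close>
    have upper: "l \<le> ?j" if l: "l \<le> i" "border u l (Suc i)" for l
    proof (cases l)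
      case (Suc k)
      then have k: "border u k i" "u ! k = u ! i" using l by (auto simp: border_Suc)
      have "l \<le> j" using prems(8) l by blast
      then have "k < j - 1" using Suc k j by (metis Suc_le_lessD Suc_pred' le_neq_implies_less
          less_Suc_eq_le)
      moreover have "border u k (j - 1)"
        using border_of_borders[OF k(1) prems(7)[OF j(1)]] calculation by simp
      ultimately show ?thesis
        using longest_border_greatest[of k "j - 1" u] Suc by (auto simp: failure_def)
    qed simp
    have bord: "border u (?j - 1) i" if "?j > 0"
    proof -
      have "j - 1 > 0" using that by (auto simp: failure_def split: if_splits)
      then have "border u (?j - 1) (j - 1)"
        using longest_border(2)[of "j - 1" u] by (simp add: failure_def)
      then show ?thesis using border_trans prems(7)[OF j(1)] by blast
    qed
    let ?s = "s\<lparr>regs := (regs s)(2 := int ?j)\<rparr>"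
    have "wp border_loop Q (n - 2) ?s"
    proof (rule less.IH[OF lt])
      show "2 * ?j + r + 1 \<le> n - 2" using prems(9) lt by simp
      show "Q n' (?s\<lparr>regs := (regs ?s)(2 := int (longest_border u (Suc i)))\<rparr>)"
        if "2 * longest_border u (Suc i) + r \<le> n'" for n'
      proof -
        have "?s\<lparr>regs := (regs ?s)(2 := int (longest_border u (Suc i)))\<rparr>
            = s\<lparr>regs := (regs s)(2 := int (longest_border u (Suc i)))\<rparr>" by simp
        then show ?thesis using prems(10)[OF that] by metis
      qed
    qed (use prems(1-9) bord upper lt in auto)
    then show "wp (Assign 2 (Load 2 (Var 2)))
        (wp (While ?b (Assign 2 (Load 2 (Var 2)))) Q) (n - 1) s"
      using prems(5,9) j load
      by (intro wp_Assign) (simp_all add: border_loop_def numeral_2_eq_2)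
  next
    assume "\<not> bval ?b s"
    then have j: "j = 0 \<or> 0 < j \<and> u ! (j - 1) = u ! i" using test by auto
    have "border u j (Suc i)"
      using j prems(7) border_Suc[of u "j - 1" i] by auto
    then have lb: "longest_border u (Suc i) = j"
      using prems(6,8) by (intro longest_border_eqI) auto
    have "Q (n - 1) (s\<lparr>regs := (regs s)(2 := int (longest_border u (Suc i)))\<rparr>)"
      using prems(9) lb by (intro prems(10)) simp
    moreover have "s\<lparr>regs := (regs s)(2 := int j)\<rparr> = s" using prems(5) by (simp add: fun_upd_idem)
    ultimately show "Q (n - 1) s" by (simp only: lb)
  qed
qed

text \<open>Each iteration costs 2 and raises \<open>m\<close>, which stays at most
  \<open>lseed (take i u) \<le> i\<close>; so the credit \<open>2 * (i - m)\<close> pays without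
  truncation.\<close>

lemma seed_loop_wp:
  assumes "0 < i" "i \<le> length u"
    and "regs s 1 = int i" "regs s 2 = int (longest_border u i)"
    and "\<And>x. mem s 4 (int x) = int (last_covered u i x)"
    and "regs s 3 = int m" "m \<le> lseed (take i u)"
    and "2 * (i - m) + r + 1 \<le> n"
    and "\<And>n'. 2 * (i - lseed (take i u)) + r \<le> n' \<Longrightarrow>
           Q n' (s\<lparr>regs := (regs s)(3 := int (lseed (take i u)))\<rparr>)"
  shows "wp seed_loop Q n s"
  using assms
proof (induction "lseed (take i u) - m" arbitrary: s n m rule: less_induct)
  case less
  note prems = less.prems
  let ?b = "BLess (Load 4 (Var 3)) (Minus (Var 1) (Var 2))" and ?L = "lseed (take i u)"
  have test: "bval ?b s \<longleftrightarrow> last_covered u i m < i - longest_border u i"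
    using prems(3-6) longest_border(1)[OF prems(1), of u] by auto
  show ?case
    unfolding seed_loop_def
  proof (rule wp_While)
    show "1 \<le> n" using prems(8) by simp
  next
    assume "bval ?b s"
    then have "last_covered u i m < i - longest_border u i" using test by simp
    then have "m \<noteq> ?L" using lseed_le_iff_last_covered(2)[OF prems(1,2)] by auto
    then have m: "m < ?L" using prems(7) by simp
    have "?L \<le> i" using lseed_le_length[of "take i u"] by simp
    then have mi: "m < i" using m by simp
    let ?s = "s\<lparr>regs := (regs s)(3 := int (Suc m))\<rparr>"
    have "wp seed_loop Q (n - 2) ?s"
    proof (rule less.hyps[of "Suc m"])
      show "2 * (i - Suc m) + r + 1 \<le> n - 2" using prems(8) mi by simp
    qed (use prems m in auto)
    then show "wp (Assign 3 (Plus (Var 3) (Const 1)))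
        (wp (While ?b (Assign 3 (Plus (Var 3) (Const 1)))) Q) (n - 1) s"
      using prems(6,8) mi
      by (intro wp_Assign) (simp_all add: seed_loop_def numeral_2_eq_2 add.commute)
  next
    assume "\<not> bval ?b s"
    then have "?L \<le> m" using lseed_le_iff_last_covered(1)[OF prems(1,2)] test by simp
    then have "m = ?L" using prems(7) by simp
    moreover have "s\<lparr>regs := (regs s)(3 := int m)\<rparr> = s" using prems(6) by (simp add: fun_upd_idem)
    ultimately show "Q (n - 1) s" using prems(8) prems(9)[of "n - 1"] by simp
  qed
qed

text \<open>For \<open>m\<close> a lower bound is enough, and monotonicity of \<open>lseed\<close>
  carries it to the next round. Array 3 is described from index 0, which is read when the longest
  border is empty, and array 4 at every index, because the pointer may read cells never
  written.\<close>

definition invariant :: "int list \<Rightarrow> nat \<Rightarrow> nat \<Rightarrow> state \<Rightarrow> bool" where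
  "invariant u i m s \<longleftrightarrow>
     i \<le> length u \<and> m \<le> lseed (take i u) \<and>
     regs s 0 = int (length u) \<and> regs s 1 = int i \<and> regs s 2 = int (failure u i) \<and>
     regs s 3 = int m \<and>
     (\<forall>x. 1 \<le> x \<longrightarrow> x \<le> length u \<longrightarrow> mem s 0 (int x) = u ! (x - 1)) \<and>
     (\<forall>x. 1 \<le> x \<longrightarrow> x \<le> i \<longrightarrow> mem s 1 (int x) = int (lseed (take x u))) \<and>
     (\<forall>x\<le>i. mem s 2 (int x + 1) = int (failure u x)) \<and>
     (\<forall>x\<le>i. mem s 3 (int x) = int (cover_length u x)) \<and>
     (\<forall>x. mem s 4 (int x) = int (last_covered u i x))"

text \<open>Each round adds one to \<open>j\<close> and may add one to \<open>i - m\<close>, while every inner iteration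
  decreases one of the two and costs two time units: hence the weights 2.\<close>
definition potential :: "int list \<Rightarrow> nat \<Rightarrow> nat \<Rightarrow> nat" where
  "potential u i m = 16 * (length u - i) + 2 * failure u i + 2 * (i - m) + 1"

text \<open>Outside the iterations of the inner loops a round costs 12, including the test of the
  main loop, for which \<open>Suc n\<close> leaves one unit. The terms for \<open>failure\<close>
  and \<open>i - m\<close> may each grow by 2; together this gives the factor 16.\<close>

lemma body_wp:
  assumes inv: "invariant u i m s" and lt: "i < length u" and n: "potential u i m \<le> Suc n"
    and post: "\<And>n' s' m'. invariant u (Suc i) m' s' \<Longrightarrow> potential u (Suc i) m' \<le> n' \<Longrightarrow> Q n' s'"
  shows "wp body Q n s"
proof -
  let ?finish = "Seq (Store 1 (Var 1) (Var 3))
    (Seq (Assign 2 (Plus (Var 2) (Const 1))) (Store 2 (Plus (Var 1) (Const 1)) (Var 2)))"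
  let ?record = "Seq (Store 3 (Var 1) (Var 4)) (Seq (Store 4 (Var 4) (Var 1)) (Seq seed_loop ?finish))"
  let ?cond = "BLess (Load 4 (Var 4)) (Minus (Var 1) (Var 4))"
  let ?rest = "Seq (Assign 4 (Load 3 (Var 2))) (Seq (If ?cond (Assign 4 (Var 1)) SKIP) ?record)"
  define f where "f = longest_border u (Suc i)"
  define c where "c = cover_length u (Suc i)"
  define c' where "c' = cover_length u f"
  define L where "L = lseed (take (Suc i) u)"
  define d where "d = length u - Suc i"
  have f: "f \<le> i" using longest_border(1)[of "Suc i" u] unfolding f_def by simp
  have c: "c = (if last_covered u i c' < Suc i - c' then Suc i else c')"
    unfolding c_def c'_def f_def by (rule cover_length_Suc)
  have c'_le: "c' \<le> i"
    using cover_length_le_self[of u f] f unfolding c'_def by simp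
  have len: "Suc i \<le> length u" "length u - i = Suc d" using lt by (auto simp: d_def)

  \<comment> \<open>The states after the successive updates, each inner loop counting as one.
    \<open>s3\<close> joins the branches of the conditional: both leave \<open>c\<close> in register
    4.\<close>
  define s1 where "s1 = s\<lparr>regs := (regs s)(1 := int (Suc i))\<rparr>"
  define s2 where "s2 = s1\<lparr>regs := (regs s1)(2 := int f)\<rparr>"
  define s3 where "s3 = s2\<lparr>regs := (regs s2)(4 := int c)\<rparr>"
  define s4 where "s4 = s3\<lparr>mem := (mem s3)(3 := (mem s3 3)(int (Suc i) := int c))\<rparr>"
  define s5 where "s5 = s4\<lparr>mem := (mem s4)(4 := (mem s4 4)(int c := int (Suc i)))\<rparr>"
  define s6 where "s6 = s5\<lparr>regs := (regs s5)(3 := int L)\<rparr>"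
  define s7 where "s7 = s6\<lparr>mem := (mem s6)(1 := (mem s6 1)(int (Suc i) := int L))\<rparr>"
  define s8 where "s8 = s7\<lparr>regs := (regs s7)(2 := int f + 1)\<rparr>"
  define s9 where "s9 = s8\<lparr>mem := (mem s8)(2 := (mem s8 2)(int (Suc i) + 1 := int f + 1))\<rparr>"
  note defs = s1_def s2_def s3_def s4_def s5_def s6_def s7_def s8_def s9_def

  have m: "m \<le> i" "m \<le> L"
    using inv lseed_le_length[of "take i u"] lseed_take_Suc[OF len(1)]
    unfolding invariant_def L_def by auto
  have R: "mem s5 4 (int x) = int (last_covered u (Suc i) x)" for x
    using inv unfolding invariant_def defs c_def by auto

  have inv': "invariant u (Suc i) L s9"
    unfolding invariant_def
  proof (intro conjI allI impI)
    fix x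
    show "mem s9 4 (int x) = int (last_covered u (Suc i) x)"
      using R[of x] by (simp add: s6_def s7_def s8_def s9_def)
  qed (use inv len in \<open>auto simp: invariant_def defs f_def c_def L_def failure_def le_Suc_eq\<close>)

  have final: "wp ?finish Q k s6"
    if k: "2 * (Suc i - L) + (16 * d + 2 * f + 6) \<le> k" for k
  proof -
    have "Q (k - 1 - 1 - 1) s9"
      by (rule post[OF inv']) (use k in \<open>simp add: potential_def failure_def f_def[symmetric] d_def\<close>)
    moreover have "regs s6 1 = int (Suc i)" "regs s6 2 = int f" "regs s6 3 = int L"
      by (simp_all add: defs)
    ultimately show ?thesis
      using k by (intro wp_Seq wp_Store wp_Assign)
        (simp_all add: s7_def s8_def s9_def add.commute)
  qed

  have pointer: "wp (Seq seed_loop ?finish) Q k s5"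
    if k: "2 * (Suc i - m) + (16 * d + 2 * f + 6) + 1 \<le> k" for k
  proof (rule wp_Seq, rule seed_loop_wp[where i = "Suc i" and m = m and r = "16 * d + 2 * f + 6"])
    show "regs s5 3 = int m" using inv by (simp add: defs invariant_def)
  qed (use len R m k final in \<open>simp_all add: defs f_def L_def\<close>)

  have covers_part: "wp ?rest  Q k s2"
    if k: "2 * f + (16 * d + 14 + 2 * (i - m)) \<le> k" for k
  proof -
    let ?s = "s2\<lparr>regs := (regs s2)(4 := int c')\<rparr>"
    have regs: "regs s3 1 = int (Suc i)" "regs s3 4 = int c" "regs s4 1 = int (Suc i)"
      "regs s4 4 = int c" "regs s2 1 = int (Suc i)" "regs s2 2 = int f"
      by (simp_all add: defs)
    have rest: "wp ?record Q (k - 3) s3"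
    proof -
      have "2 * (Suc i - m) + (16 * d + 2 * f + 6) + 1 \<le> k - 3 - 1 - 1" using k m by linarith
      from pointer[OF this] show ?thesis
        using k regs by (intro wp_Seq[of "Store _ _ _"] wp_Store)
          (simp_all add: s4_def s5_def)
    qed
    have load: "mem s2 3 (int f) = int c'"
      using inv f by (simp add: defs invariant_def c'_def)
    have test: "bval ?cond ?s
        \<longleftrightarrow> last_covered u i c' < Suc i - c'"
      using inv c'_le by (auto simp: defs invariant_def)
    have "wp (If ?cond (Assign 4 (Var 1)) SKIP) (wp ?record Q) (k - 1) ?s"
    proof (rule wp_If)
      show "1 \<le> k - 1" using k by simp
    next
      assume "bval ?cond ?s"
      then have "c = Suc i" using c test by simp
      then show "wp (Assign 4 (Var 1)) (wp ?record Q) (k - 1 - 1) ?s"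
        using k rest regs by (intro wp_Assign) (simp_all add: s3_def numeral_3_eq_3)
    next
      assume "\<not> bval ?cond ?s"
      then have "c = c'" using c test by simp
      then show "wp SKIP (wp ?record Q) (k - 1 - 1) ?s"
        using k rest by (intro wp_SKIP) (simp_all add: s3_def numeral_3_eq_3)
    qed
    then show ?thesis
      using k load regs by (intro wp_Seq[of "Assign _ _"] wp_Seq[of "If _ _ _"] wp_Assign) simp_all
  qed

  have kmp: "wp border_loop (wp ?rest Q) (n - 1) s1"
  proof (rule border_loop_wp[where i = i and j = "failure u i"
          and r = "16 * d + 14 + 2 * (i - m)"])
    show "failure u i \<le> i" by (rule failure_le)
    show "border u (failure u i - 1) i" if "0 < failure u i"
      using that longest_border(2)[of i u] by (auto simp: failure_def split: if_splits)
    show "l \<le> failure u i" if "l \<le> i" "border u l (Suc i)" for l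
    proof (cases l)
      case (Suc k)
      then show ?thesis
        using that longest_border_greatest[of k i u] by (auto simp: failure_def border_Suc)
    qed simp
    show "2 * failure u i + (16 * d + 14 + 2 * (i - m)) + 1 \<le> n - 1"
      using n len by (simp add: potential_def)
    show "wp ?rest Q k
      (s1\<lparr>regs := (regs s1)(2 := int (longest_border u (Suc i)))\<rparr>)"
      if "2 * longest_border u (Suc i) + (16 * d + 14 + 2 * (i - m)) \<le> k" for k
      using covers_part[of k] that by (simp add: s2_def f_def)
  qed (use inv len in \<open>auto simp: invariant_def s1_def\<close>)
  have "regs s 1 = int i" using inv by (simp add: invariant_def)
  then show ?thesis
    unfolding body_def using kmp n len
    by (intro wp_Seq[of "Assign _ _"] wp_Assign wp_Seq[of border_loop])
      (simp_all add: s1_def potential_def add.commute)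
qed

lemma main_loop_wp:
  assumes "invariant u i m s" "potential u i m \<le> n"
    and "\<And>n' m' s'. invariant u (length u) m' s' \<Longrightarrow> Q n' s'"
  shows "wp main_loop Q n s"
  using assms
proof (induction "length u - i" arbitrary: i m s n rule: less_induct)
  case less
  have bound: "i \<le> length u" and test: "bval (BLess (Var 1) (Var 0)) s \<longleftrightarrow> i < length u"
    using less.prems(1) by (auto simp: invariant_def)
  show ?case
    unfolding main_loop_def
  proof (rule wp_While)
    show "1 \<le> n" using less.prems(2) by (simp add: potential_def)
  next
    assume "bval (BLess (Var 1) (Var 0)) s"
    then have lt: "i < length u" using test by simp
    show "wp body (wp (While (BLess (Var 1) (Var 0)) body) Q) (n - 1) s"
    proof (rule body_wp[OF less.prems(1) lt])
      show "potential u i m \<le> Suc (n - 1)" using less.prems(2) by simp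
      show "wp (While (BLess (Var 1) (Var 0)) body) Q n' s'"
        if "invariant u (Suc i) m' s'" "potential u (Suc i) m' \<le> n'" for n' s' m'
        using less.hyps[OF _ that less.prems(3)] lt by (simp add: main_loop_def)
    qed
  next
    assume "\<not> bval (BLess (Var 1) (Var 0)) s"
    then have "i = length u" using test bound by simp
    then show "Q (n - 1) s" using less.prems(1,3) by simp
  qed
qed

theorem theorem1:
  fixes \<sigma> :: nat
  shows "\<exists>(P :: com) (C :: nat). \<forall>u :: int list. set u \<subseteq> {0..<int \<sigma>} \<longrightarrow>
           (\<exists>t s'. big_step P (input_state u) t s' \<and> t \<le> C * (length u + 1) \<and>
                   (\<forall>i \<in> {1..length u}. mem s' 1 (int i) = int (lseed (take i u))))"
proof (rule exI[of _ main_loop], rule exI[of _ 17], intro allI impI)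
  fix u :: "int list"
  have "wp main_loop (\<lambda>_ s'. \<forall>i \<in> {1..length u}. mem s' 1 (int i) = int (lseed (take i u)))
      (17 * (length u + 1)) (input_state u)"
  proof (rule main_loop_wp)
    show "invariant u 0 0 (input_state u)"
      by (auto simp: invariant_def input_state_def failure_def nat_diff_distrib)
    \<comment> \<open>The initial potential is \<open>16 * length u + 1\<close>, where the 1 pays
      for the last test of the main loop.\<close>
    show "potential u 0 0 \<le> 17 * (length u + 1)"
      by (simp add: potential_def failure_def)
  qed (auto simp: invariant_def)
  then show "\<exists>t s'. big_step main_loop (input_state u) t s' \<and> t \<le> 17 * (length u + 1) \<and>
      (\<forall>i \<in> {1..length u}. mem s' 1 (int i) = int (lseed (take i u)))"
    unfolding wp_def by blast
qed

end
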